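(* Let $n$ be a positive even integer. Then (i) if $n\ge 4$, $\det(L_n)=\det(L_{n-2})+4(n-2)$; (ii) $\det(L_n)=(n-1)^2$.
   Context: A tournament is a directed graph with exactly one arc between each pair of distinct vertices; $u\rightarrow v$ means the arc goes from $u$ to $v$. For a tournament $T$ on vertices $v_1,\dots,v_n$, its skew-adjacency matrix is the zero-diagonal matrix $S_T=[s_{ij}]$ with $s_{ij}=-s_{ji}=1$ if $v_i\rightarrow v_j$, and $\det(T):=\det(S_T)$ (independent of the vertex ordering). For $m\ge 2$, $L_m$ is the tournament on vertices $u_1,\dots,u_m$ with $u_i\rightarrow u_j$ for $1\le i<j\le m-1$, and for $1\le i\le m-1$: $u_m\rightarrow u_i$ if $i$ is odd and $u_i\rightarrow u_m$ if $i$ is even. *)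

theory Defs
  imports
    "Graph_Theory.Pair_Digraph"
    "Jordan_Normal_Form.Determinant"
begin

locale tournament = pair_digraph T for T :: "'a pair_pre_digraph" +
  assumes ex1_arc:
    "\<lbrakk>u \<in> pverts T; v \<in> pverts T; u \<noteq> v\<rbrakk> \<Longrightarrow> (u, v) \<in> parcs T \<longleftrightarrow> (v, u) \<notin> parcs T"

definition vertex_ordering :: "'a pair_pre_digraph \<Rightarrow> 'a list \<Rightarrow> bool" where
  "vertex_ordering T vs \<longleftrightarrow> distinct vs \<and> set vs = pverts T"

definition skew_adjacency_matrix :: "'a pair_pre_digraph \<Rightarrow> 'a list \<Rightarrow> int mat" where
  "skew_adjacency_matrix T vs = mat (length vs) (length vs) (\<lambda>(i, j).
     if (vs ! i, vs ! j) \<in> parcs T then 1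
     else if (vs ! j, vs ! i) \<in> parcs T then - 1
     else 0)"

(* The choice of the vertex ordering is immaterial: see tournament_det_eq below. *)
definition tournament_det :: "'a pair_pre_digraph \<Rightarrow> int" where
  "tournament_det T = det (skew_adjacency_matrix T (SOME vs. vertex_ordering T vs))"

definition L :: "nat \<Rightarrow> nat pair_pre_digraph" where
  "L m = \<lparr> pverts = {1..m},
           parcs = {(i, j). 1 \<le> i \<and> i < j \<and> j \<le> m - 1}
                 \<union> {(m, i) | i. 1 \<le> i \<and> i \<le> m - 1 \<and> odd i}
                 \<union> {(i, m) | i. 1 \<le> i \<and> i \<le> m - 1 \<and> even i} \<rparr>"

lemma det_skew_adjacency_matrix_ordering:
  assumes "vertex_ordering T vs" "vertex_ordering T ws"
  shows "det (skew_adjacency_matrix T vs) = det (skew_adjacency_matrix T ws)"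
proof -
  define n where "n = length vs"
  have "mset ws = mset vs"
    using assms set_eq_iff_mset_eq_distinct[of ws vs] by (simp add: vertex_ordering_def)
  then obtain p where p: "p permutes {..<length vs}" and ws: "permute_list p vs = ws"
    by (rule mset_eq_permutation)
  have p': "p permutes {0..<n}" using p by (simp add: n_def lessThan_atLeast0)
  have pn: "p i < n" if "i < n" for i
    using permutes_in_image[OF p', of i] that by simp
  define A where "A = skew_adjacency_matrix T vs"
  define B where "B = mat n n (\<lambda>(i, j). A $$ (p i, j))"
  have A: "A \<in> carrier_mat n n" by (simp add: A_def skew_adjacency_matrix_def n_def)
  have B: "B \<in> carrier_mat n n" by (simp add: B_def)
  have len: "length ws = n" using ws by (auto simp: n_def)
  have nth: "ws ! i = vs ! p i" if "i < n" for i
    using ws p that by (auto simp: n_def permute_list_nth)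
  have C: "skew_adjacency_matrix T ws = transpose_mat (mat n n (\<lambda>(i, j). transpose_mat B $$ (p i, j)))"
    using pn by (intro eq_matI)
      (auto simp: skew_adjacency_matrix_def A_def B_def len nth n_def[symmetric])
  have "det (skew_adjacency_matrix T ws) = det (mat n n (\<lambda>(i, j). transpose_mat B $$ (p i, j)))"
    unfolding C by (rule det_transpose[of _ n]) simp
  also have "\<dots> = signof p * det (transpose_mat B)"
    using B p' by (intro det_permute_rows) auto
  also have "det (transpose_mat B) = det B" using B by (rule det_transpose)
  also have "det B = signof p * det A"
    unfolding B_def using A p' by (rule det_permute_rows)
  also have "signof p * (signof p * det A) = det A"
    by (auto simp: sign_def)
  finally show ?thesis by (simp add: A_def)
qed

lemma tournament_det_eq:
  assumes "vertex_ordering T vs"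
  shows "tournament_det T = det (skew_adjacency_matrix T vs)"
  unfolding tournament_det_def
  using assms by (intro det_skew_adjacency_matrix_ordering) (auto intro: someI)

lemma tournament_L: "tournament (L m)"
proof
  have "parcs (L m) \<subseteq> {1..m} \<times> {1..m}" by (auto simp: L_def)
  then show "finite (parcs (L m))" by (rule finite_subset) simp
qed (auto simp: L_def)

end

theory Submission
  imports Defs
begin

text \<open>
  Write \<open>n = 2m + 2\<close>. Subtracting from each row of the skew-adjacency matrix of \<open>L\<^sub>n\<close> the next one
  makes its first \<open>2m\<close> rows bidiagonal up to the last column. The bidiagonal part is inverted by
  the alternating upper triangular matrix with entries \<open>(-1)\<^sup>i\<^sup>+\<^sup>j\<close>, so the corresponding column
  operations produce a lower triangular matrix with diagonal \<open>1, \<dots>, 1, -(n-1), -(n-1)\<close>.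
\<close>

text \<open>Indices start at 0, so \<open>i\<close> stands for vertex \<open>i + 1\<close> and the
  parities in \<open>L\<close> flip: odd vertices have even indices.\<close>

definition L_mat :: "nat \<Rightarrow> int mat" where
  "L_mat m = mat (2*m+2) (2*m+2) (\<lambda>(i, j).
     if i = j then 0
     else if j = 2*m+1 then - ((-1) ^ i)
     else if i = 2*m+1 then (-1) ^ j
     else if i < j then 1 else - 1)"

definition diff_mat :: "nat \<Rightarrow> int mat" where
  "diff_mat n = mat n n (\<lambda>(i, j). if j = i then 1 else if j = Suc i then - 1 else 0)"

text \<open>Closed form of \<open>diff_mat (2*m+2) * L_mat m\<close>. Row \<open>2*m\<close> is
  special because the alternating last row is subtracted from it; the last row is that of
  \<open>L_mat m\<close>.\<close>

definition L_diff_mat :: "nat \<Rightarrow> int mat" where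
  "L_diff_mat m = mat (2*m+2) (2*m+2) (\<lambda>(i, j).
     if i < 2*m then
       (if j = i \<or> j = Suc i then 1 else if j = 2*m+1 then - 2 * (-1) ^ i else 0)
     else if i = 2*m then (if j < 2*m then - 1 - (-1) ^ j else - 1)
     else (if j = 2*m+1 then 0 else (-1) ^ j))"

text \<open>
  The last column is chosen so that it is annihilated by all rows of \<^const>\<open>L_diff_mat\<close> but the last.
\<close>

definition alternating_mat :: "nat \<Rightarrow> int mat" where
  "alternating_mat m = mat (2*m+2) (2*m+2) (\<lambda>(i, j).
     if j = 2*m+1 then (if i = 2*m+1 then 1 else (-1) ^ i * (2 * int m - 1 - 2 * int i))
     else if i \<le> j then (-1) ^ (i + j) else 0)"

lemma tournament_det_L: "tournament_det (L (2*m+2)) = det (L_mat m)"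
proof -
  let ?vs = "[1..<Suc (2*m+2)]"
  have "vertex_ordering (L (2*m+2)) ?vs"
    by (auto simp: vertex_ordering_def L_def)
  moreover have "skew_adjacency_matrix (L (2*m+2)) ?vs = L_mat m"
  proof (rule eq_matI)
    fix i j assume "i < dim_row (L_mat m)" "j < dim_col (L_mat m)"
    then have ij: "i < 2*m+2" "j < 2*m+2" by (auto simp: L_mat_def)
    then have "?vs ! i = Suc i" "?vs ! j = Suc j" "length ?vs = 2*m+2"
      by (auto simp del: upt_Suc)
    with ij show "skew_adjacency_matrix (L (2*m+2)) ?vs $$ (i, j) = L_mat m $$ (i, j)"
      by (auto simp: skew_adjacency_matrix_def L_mat_def L_def simp del: upt_Suc)
  qed (auto simp: skew_adjacency_matrix_def L_mat_def)
  ultimately show ?thesis by (simp add: tournament_det_eq)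
qed

lemma det_diff_mat: "det (diff_mat n) = 1"
proof -
  have "det (diff_mat n) = prod_list (diag_mat (diff_mat n))"
    by (rule det_upper_triangular[of _ n]) (auto simp: diff_mat_def upper_triangular_def)
  also have "diag_mat (diff_mat n) = replicate n 1"
    by (rule nth_equalityI) (auto simp: diag_mat_def diff_mat_def)
  finally show ?thesis by (simp add: prod_list_replicate)
qed

lemma det_alternating_mat: "det (alternating_mat m) = 1"
proof -
  have "det (alternating_mat m) = prod_list (diag_mat (alternating_mat m))"
    by (rule det_upper_triangular[of _ "2*m+2"])
      (auto simp: alternating_mat_def upper_triangular_def)
  also have "diag_mat (alternating_mat m) = replicate (2*m+2) 1"
    by (rule nth_equalityI) (auto simp: diag_mat_def alternating_mat_def simp del: replicate_Suc upt_Suc)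
  finally show ?thesis by (simp add: prod_list_replicate)
qed

lemma diff_mat_mult_index:
  assumes "A \<in> carrier_mat n k" "i < n" "j < k"
  shows "(diff_mat n * A) $$ (i, j) = A $$ (i, j) - (if Suc i < n then A $$ (Suc i, j) else 0)"
proof -
  have "(diff_mat n * A) $$ (i, j)
      = (\<Sum>l<n. (if l = i then 1 else if l = Suc i then - 1 else 0) * A $$ (l, j))"
    using assms by (auto simp: diff_mat_def scalar_prod_def lessThan_atLeast0 intro!: sum.cong)
  \<comment> \<open>The two cases exclude each other, so the sum splits into two single-point sums;
    the second is empty for the last row.\<close>
  also have "\<dots> = (\<Sum>l<n. (if l = i then A $$ (l, j) else 0) - (if l = Suc i then A $$ (l, j) else 0))"
    by (intro sum.cong) auto
  also have "\<dots> = A $$ (i, j) - (if Suc i < n then A $$ (Suc i, j) else 0)"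
    using assms by (simp add: sum_subtractf)
  finally show ?thesis .
qed

lemma diff_mat_mult_L_mat: "diff_mat (2*m+2) * L_mat m = L_diff_mat m"
proof (rule eq_matI)
  fix i j assume "i < dim_row (L_diff_mat m)" "j < dim_col (L_diff_mat m)"
  then have ij: "i < 2*m+2" "j < 2*m+2" by (auto simp: L_diff_mat_def)
  have "L_mat m \<in> carrier_mat (2*m+2) (2*m+2)" by (simp add: L_mat_def)
  from diff_mat_mult_index[OF this ij] ij
  show "(diff_mat (2*m+2) * L_mat m) $$ (i, j) = L_diff_mat m $$ (i, j)"
    by (auto simp: L_mat_def L_diff_mat_def)
qed (auto simp: diff_mat_def L_mat_def L_diff_mat_def)

lemma sum_minus_one_power_even: "(\<Sum>j<2*m. (-1) ^ j :: int) = 0"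
  by (induction m) auto

text \<open>Odd \<open>j\<close> contribute 0 and even \<open>j = 2 * t\<close> contribute
  \<open>- 2 * (c - 4 * t)\<close>. The constant \<open>c\<close> stays free of \<open>m\<close> for
  the induction; it is used at \<open>c = 2 * int m - 1\<close>.\<close>

lemma sum_alternating_linear:
  "(\<Sum>j<2*m. (- 1 - (-1) ^ j) * ((-1) ^ j * (c - 2 * int j))) = - 2 * int m * (c - 2 * int m + 2)"
  by (induction m) (auto simp: algebra_simps)

lemma sum_linear: "(\<Sum>j<k. c - 2 * int j) = int k * (c - int k + 1)"
  by (induction k) (auto simp: algebra_simps)

text \<open>For a lower triangular determinant, the entries on and above the diagonal are what
  matters. In rows \<open>i < 2*m\<close>, adjacent entries of an alternating column cancel unless
  \<open>i = j\<close>, where the lower one is 0.\<close>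

lemma L_diff_mat_mult_alternating_mat_index:
  assumes "i \<le> j" "j < 2*m+2"
  shows "(L_diff_mat m * alternating_mat m) $$ (i, j)
    = (if i \<noteq> j then 0 else if i < 2*m then 1 else - (2 * int m + 1))"
proof -
  let ?C = "\<lambda>k. L_diff_mat m $$ (i, k)" and ?W = "\<lambda>k. alternating_mat m $$ (k, j)"
  have i: "i < 2*m+2" using assms by simp
  have prod: "(L_diff_mat m * alternating_mat m) $$ (i, j) = (\<Sum>k<2*m+2. ?C k * ?W k)"
    using assms i
    by (auto simp: L_diff_mat_def alternating_mat_def scalar_prod_def lessThan_atLeast0
        intro!: sum.cong)
  have prod': "(L_diff_mat m * alternating_mat m) $$ (i, j)
      = (\<Sum>k<2*m. ?C k * ?W k) + ?C (2*m) * ?W (2*m) + ?C (2*m+1) * ?W (2*m+1)"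
    unfolding prod by simp
  consider "i < 2*m" | "i = 2*m" "j = 2*m" | "i = 2*m" "j = 2*m+1" | "i = 2*m+1" "j = 2*m+1"
    using assms by linarith
  then show ?thesis
  proof cases
    case 1
    \<comment> \<open>Since \<open>i < 2*m\<close>, the positions \<open>i\<close>,
      \<open>Suc i\<close> and \<open>2*m+1\<close> of the nonzero entries are distinct.\<close>
    have "(\<Sum>k<2*m+2. ?C k * ?W k)
        = (\<Sum>k<2*m+2. (if k = i then ?W k else 0) + (if k = Suc i then ?W k else 0)
             + (if k = 2*m+1 then - 2 * (-1) ^ i * ?W k else 0))"
      using 1 by (intro sum.cong) (auto simp: L_diff_mat_def)
    also have "\<dots> = ?W i + ?W (Suc i) - 2 * (-1) ^ i * ?W (2*m+1)"
      using 1 by (simp add: sum.distrib del: sum.lessThan_Suc)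
    also have "\<dots> = (if i \<noteq> j then 0 else 1)"
      using 1 assms by (auto simp: alternating_mat_def algebra_simps)
    finally show ?thesis using 1 by (simp add: prod)
  next
    case 2
    have "(\<Sum>k<2*m. ?C k * ?W k) = (\<Sum>k<2*m. - 1 - (-1) ^ k)"
    proof (intro sum.cong refl)
      fix k assume "k \<in> {..<2*m}"
      then have "?C k = - 1 - (-1) ^ k" "?W k = (-1) ^ k"
        using 2 by (auto simp: L_diff_mat_def alternating_mat_def power_add)
      then show "?C k * ?W k = - 1 - (-1) ^ k"
        by (cases "even k") auto
    qed
    then show ?thesis
      using 2 unfolding prod'
      by (simp add: sum_subtractf sum_minus_one_power_even L_diff_mat_def alternating_mat_def)
  next
    case 3
    \<comment> \<open>This sum is \<open>- 2 * m\<close>, and the last two terms are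
      \<open>2 * m + 1\<close> and \<open>- 1\<close>. This cancellation fixes the constant
      \<open>2 * int m - 1\<close> in the last column.\<close>
    have "(\<Sum>k<2*m. ?C k * ?W k)
        = (\<Sum>k<2*m. (- 1 - (-1) ^ k) * ((-1) ^ k * (2 * int m - 1 - 2 * int k)))"
      using 3 by (intro sum.cong) (auto simp: L_diff_mat_def alternating_mat_def)
    then show ?thesis
      using 3 unfolding prod' sum_alternating_linear
      by (simp add: L_diff_mat_def alternating_mat_def)
  next
    case 4
    \<comment> \<open>The signs square to 1, and the linear sum is 0 by the symmetry of
      \<open>k\<close> and \<open>2*m - 1 - k\<close>. The term at \<open>k = 2*m\<close> gives the
      whole entry.\<close>
    have "(\<Sum>k<2*m. ?C k * ?W k) = (\<Sum>k<2*m. (2 * int m - 1) - 2 * int k)"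
      using 4 by (intro sum.cong) (auto simp: L_diff_mat_def alternating_mat_def
          simp flip: mult.assoc power_add mult_2)
    then show ?thesis
      using 4 unfolding prod' sum_linear
      by (simp add: L_diff_mat_def alternating_mat_def)
  qed
qed

lemma det_L_mat: "det (L_mat m) = (2 * int m + 1)\<^sup>2"
proof -
  let ?n = "2*m+2" and ?T = "L_diff_mat m * alternating_mat m"
  have S: "L_mat m \<in> carrier_mat ?n ?n" and D: "diff_mat ?n \<in> carrier_mat ?n ?n"
    and C: "L_diff_mat m \<in> carrier_mat ?n ?n" and W: "alternating_mat m \<in> carrier_mat ?n ?n"
    by (simp_all add: L_mat_def diff_mat_def L_diff_mat_def alternating_mat_def)
  have T: "?T \<in> carrier_mat ?n ?n" using C W by simp
  \<comment> \<open>Both multipliers are unit triangular, so they leave the determinant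
    unchanged.\<close>
  have "det (L_mat m) = det (diff_mat ?n * L_mat m) * det (alternating_mat m)"
    by (simp only: det_mult[OF D S] det_diff_mat det_alternating_mat mult_1 mult_1_right)
  also have "\<dots> = det ?T"
    by (simp only: diff_mat_mult_L_mat det_mult[OF C W])
  also have "\<dots> = prod_list (diag_mat ?T)"
    by (rule det_lower_triangular[OF _ T]) (simp add: L_diff_mat_mult_alternating_mat_index)
  also have "diag_mat ?T = map (\<lambda>i. ?T $$ (i, i)) [0..<?n]"
    using T by (simp only: diag_mat_def carrier_matD)
  also have "\<dots> = map (\<lambda>i. if i < 2*m then 1 else - (2 * int m + 1)) [0..<?n]"
    by (rule map_cong[OF refl], subst L_diff_mat_mult_alternating_mat_index) auto
  also have "\<dots> = map (\<lambda>i. 1) [0..<2*m] @ [- (2 * int m + 1), - (2 * int m + 1)]"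
    by simp
  also have "prod_list \<dots> = (2 * int m + 1)\<^sup>2"
    by (simp add: map_replicate_const prod_list_replicate power2_eq_square algebra_simps)
  finally show ?thesis .
qed

lemma tournament_det_L_even:
  assumes "n > 0" "even n"
  shows "tournament_det (L n) = (int n - 1)\<^sup>2"
proof -
  from \<open>even n\<close> obtain k where "n = 2 * k" by (rule evenE)
  moreover from this \<open>n > 0\<close> obtain m where "k = Suc m" by (cases k) auto
  ultimately have "n = 2*m+2" by simp
  then show ?thesis by (simp only: tournament_det_L det_L_mat) (simp add: algebra_simps)
qed

theorem theorem4p3:
  fixes n :: nat
  assumes "n > 0" and "even n"
  shows "(n \<ge> 4 \<longrightarrow> tournament_det (L n) = tournament_det (L (n - 2)) + 4 * (int n - 2))
       \<and> tournament_det (L n) = (int n - 1)\<^sup>2"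
proof (intro conjI impI)
  show "tournament_det (L n) = (int n - 1)\<^sup>2"
    using assms by (rule tournament_det_L_even)
  \<comment> \<open>The recurrence is read off the closed form at \<open>n\<close> and at
    \<open>n - 2\<close>, which is positive here:
    \<open>(n-1)^2 - (n-3)^2 = 4 * (n-2)\<close>.\<close>
  assume "n \<ge> 4"
  then have "tournament_det (L (n - 2)) = (int n - 3)\<^sup>2"
    using tournament_det_L_even[of "n - 2"] assms by (simp add: of_nat_diff)
  then show "tournament_det (L n) = tournament_det (L (n - 2)) + 4 * (int n - 2)"
    using tournament_det_L_even[OF assms] by (simp add: power2_eq_square algebra_simps)
qed

end
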